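(* Let $\mathcal{L}$ be a relational language and let $\mathcal{M},\mathcal{N}$ be elementarily indivisible $\mathcal{L}$-structures. Then the lexicographic products $\mathcal{M}[\mathcal{N}]$ and $\mathcal{M}[\mathcal{N}]^s$ are elementarily indivisible.
   Context: A structure is elementarily indivisible if for every coloring of its universe in two colors there is a monochromatic substructure isomorphic to it which is an elementary substructure of it. The lexicographic product $\mathcal{M}[\mathcal{N}]$ is the $\mathcal{L}$-structure with universe $M\times N$ where, for each $n$-ary $R\in\mathcal{L}$, $((a_1,b_1),\dots,(a_n,b_n))\in R$ iff either ($a_1=\dots=a_n$ and $\mathcal{N}\models R(b_1,\dots,b_n)$) or ($a_i\neq a_j$ for some $i,j$ and $\mathcal{M}\models R(a_1,\dots,a_n)$). $\mathcal{M}[\mathcal{N}]^s$ is its expansion by a new binary relation $s$ interpreted as $\{((a_1,b_1),(a_2,b_2)) : a_1=a_2\}$. *)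

theory Defs imports Main begin

text \<open>
  A relational language is a set of relation symbols with arities. The symbols are a set rather
  than a whole type so that the empty language is included.
\<close>

record 'r rel_language =
  symbols :: "'r set"
  arity :: "'r \<Rightarrow> nat"

record ('r, 'a) rel_structure =
  universe :: "'a set"
  interp :: "'r \<Rightarrow> 'a list set"

definition tuples :: "nat \<Rightarrow> 'a set \<Rightarrow> 'a list set" where
  "tuples n A = {xs. length xs = n \<and> set xs \<subseteq> A}"

text \<open>
  The interpretation of symbols outside the language is arbitrary; all notions below ignore it.
\<close>

definition is_structure :: "'r rel_language \<Rightarrow> ('r, 'a) rel_structure \<Rightarrow> bool" where
  "is_structure L M \<longleftrightarrow>
     universe M \<noteq> {} \<and> (\<forall>R\<in>symbols L. interp M R \<subseteq> tuples (arity L R) (universe M))"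

text \<open>
  First-order formulas with equality. Since the language is relational, the only terms are the
  variables, which are named by natural numbers.
\<close>

datatype 'r fm =
    Eq nat nat
  | Rel 'r "nat list"
  | Neg "'r fm"
  | Conj "'r fm" "'r fm"
  | Ex nat "'r fm"

primrec formula_of :: "'r rel_language \<Rightarrow> 'r fm \<Rightarrow> bool" where
  "formula_of L (Eq i j) \<longleftrightarrow> True"
| "formula_of L (Rel R is) \<longleftrightarrow> R \<in> symbols L \<and> length is = arity L R"
| "formula_of L (Neg \<phi>) \<longleftrightarrow> formula_of L \<phi>"
| "formula_of L (Conj \<phi> \<psi>) \<longleftrightarrow> formula_of L \<phi> \<and> formula_of L \<psi>"
| "formula_of L (Ex i \<phi>) \<longleftrightarrow> formula_of L \<phi>"

primrec sat :: "('r, 'a) rel_structure \<Rightarrow> (nat \<Rightarrow> 'a) \<Rightarrow> 'r fm \<Rightarrow> bool" where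
  "sat M v (Eq i j) \<longleftrightarrow> v i = v j"
| "sat M v (Rel R is) \<longleftrightarrow> map v is \<in> interp M R"
| "sat M v (Neg \<phi>) \<longleftrightarrow> \<not> sat M v \<phi>"
| "sat M v (Conj \<phi> \<psi>) \<longleftrightarrow> sat M v \<phi> \<and> sat M v \<psi>"
| "sat M v (Ex i \<phi>) \<longleftrightarrow> (\<exists>a\<in>universe M. sat M (v(i := a)) \<phi>)"

definition substructure ::
    "'r rel_language \<Rightarrow> ('r, 'a) rel_structure \<Rightarrow> ('r, 'a) rel_structure \<Rightarrow> bool" where
  "substructure L A M \<longleftrightarrow>
     is_structure L A \<and> is_structure L M \<and> universe A \<subseteq> universe M \<and>
     (\<forall>R\<in>symbols L. interp A R = interp M R \<inter> tuples (arity L R) (universe A))"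

definition elementary_substructure ::
    "'r rel_language \<Rightarrow> ('r, 'a) rel_structure \<Rightarrow> ('r, 'a) rel_structure \<Rightarrow> bool" where
  "elementary_substructure L A M \<longleftrightarrow>
     substructure L A M \<and>
     (\<forall>\<phi> v. formula_of L \<phi> \<longrightarrow> range v \<subseteq> universe A \<longrightarrow> (sat A v \<phi> \<longleftrightarrow> sat M v \<phi>))"

definition isomorphic ::
    "'r rel_language \<Rightarrow> ('r, 'a) rel_structure \<Rightarrow> ('r, 'b) rel_structure \<Rightarrow> bool" where
  "isomorphic L M N \<longleftrightarrow>
     (\<exists>f. bij_betw f (universe M) (universe N) \<and>
          (\<forall>R\<in>symbols L. \<forall>xs\<in>tuples (arity L R) (universe M).
             xs \<in> interp M R \<longleftrightarrow> map f xs \<in> interp N R))"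

definition monochromatic :: "('a \<Rightarrow> bool) \<Rightarrow> 'a set \<Rightarrow> bool" where
  "monochromatic c A \<longleftrightarrow> (\<exists>k. \<forall>a\<in>A. c a = k)"

definition elementarily_indivisible ::
    "'r rel_language \<Rightarrow> ('r, 'a) rel_structure \<Rightarrow> bool" where
  "elementarily_indivisible L M \<longleftrightarrow>
     is_structure L M \<and>
     (\<forall>c :: 'a \<Rightarrow> bool. \<exists>A. monochromatic c (universe A) \<and> isomorphic L A M \<and>
        elementary_substructure L A M)"

definition lexicographic_product ::
    "'r rel_language \<Rightarrow> ('r, 'a) rel_structure \<Rightarrow> ('r, 'b) rel_structure
      \<Rightarrow> ('r, 'a \<times> 'b) rel_structure" where
  "lexicographic_product L M N =
     \<lparr>universe = universe M \<times> universe N,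
      interp = (\<lambda>R. {ps \<in> tuples (arity L R) (universe M \<times> universe N).
        (\<forall>p\<in>set ps. \<forall>q\<in>set ps. fst p = fst q) \<and> map snd ps \<in> interp N R \<or>
        (\<exists>p\<in>set ps. \<exists>q\<in>set ps. fst p \<noteq> fst q) \<and> map fst ps \<in> interp M R})\<rparr>"

text \<open>
  The language with one new binary relation symbol \<open>s\<close>: the old symbols are embedded by
  \<^const>\<open>Some\<close>, and \<^const>\<open>None\<close> plays the role of \<open>s\<close>.
\<close>

definition add_s :: "'r rel_language \<Rightarrow> 'r option rel_language" where
  "add_s L = \<lparr>symbols = insert None (Some ` symbols L), arity = case_option 2 (arity L)\<rparr>"

definition lexicographic_product_s ::
    "'r rel_language \<Rightarrow> ('r, 'a) rel_structure \<Rightarrow> ('r, 'b) rel_structure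
      \<Rightarrow> ('r option, 'a \<times> 'b) rel_structure" where
  "lexicographic_product_s L M N =
     \<lparr>universe = universe (lexicographic_product L M N),
      interp = case_option
        {[p, q] | p q. p \<in> universe M \<times> universe N \<and> q \<in> universe M \<times> universe N \<and> fst p = fst q}
        (interp (lexicographic_product L M N))\<rparr>"

end

theory Submission imports Defs begin

text \<open>
  Given a colouring of \<open>M \<times> N\<close>, choose for every \<open>a \<in> M\<close> a monochromatic elementary copy \<open>N\<^sub>a\<close> of
  \<open>N\<close> for the colouring of the fibre over \<open>a\<close>, and then an elementary copy \<open>M\<^sub>0\<close> of \<open>M\<close> on which the
  colour of \<open>N\<^sub>a\<close> does not depend on \<open>a\<close>. The union of the sets \<open>{a} \<times> N\<^sub>a\<close> over \<open>a \<in> M\<^sub>0\<close> is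
  monochromatic and isomorphic to the product. It is elementary by an Ehrenfeucht--Fraisse
  argument: the second player wins on the product by answering the first coordinate according to
  a strategy between \<open>M\<^sub>0\<close> and \<open>M\<close>, and the second coordinate according to a strategy
  between the fibres. The game includes the relation \<open>s\<close>, and the product without \<open>s\<close> is a reduct.
\<close>

section \<open>Ehrenfeucht--Fraisse games\<close>

text \<open>A position of the game is a bare set of pairs rather than a function, so that positions
  can be projected to a coordinate and cut into fibres. A nullary symbol is compared even when
  \<open>P\<close> is empty, through the empty list.\<close>

definition partial_iso ::
    "'r rel_language \<Rightarrow> ('r, 'a) rel_structure \<Rightarrow> ('r, 'b) rel_structure \<Rightarrow> ('a \<times> 'b) set \<Rightarrow> bool" where
  "partial_iso L M N P \<longleftrightarrow>
     (\<forall>p\<in>P. \<forall>q\<in>P. fst p = fst q \<longleftrightarrow> snd p = snd q) \<and>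
     (\<forall>R\<in>symbols L. \<forall>ps. set ps \<subseteq> P \<longrightarrow> length ps = arity L R \<longrightarrow>
        (map fst ps \<in> interp M R \<longleftrightarrow> map snd ps \<in> interp N R))"

text \<open>The second player has a winning strategy for \<open>k\<close> more rounds from position
  \<open>P\<close>. Only the final position is tested; since positions only grow, this also
  constrains the earlier ones.\<close>

primrec ef ::
    "'r rel_language \<Rightarrow> ('r, 'a) rel_structure \<Rightarrow> ('r, 'b) rel_structure \<Rightarrow> nat
      \<Rightarrow> ('a \<times> 'b) set \<Rightarrow> bool" where
  "ef L M N 0 P \<longleftrightarrow> partial_iso L M N P"
| "ef L M N (Suc k) P \<longleftrightarrow>
     (\<forall>a\<in>universe M. \<exists>b\<in>universe N. ef L M N k (insert (a, b) P)) \<and>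
     (\<forall>b\<in>universe N. \<exists>a\<in>universe M. ef L M N k (insert (a, b) P))"

lemma partial_iso_mono: "partial_iso L M N P \<Longrightarrow> Q \<subseteq> P \<Longrightarrow> partial_iso L M N Q"
  unfolding partial_iso_def by (meson subset_iff)

lemma partial_isoD:
  assumes "partial_iso L M N P" "R \<in> symbols L" "set ps \<subseteq> P" "length ps = arity L R"
  shows "map fst ps \<in> interp M R \<longleftrightarrow> map snd ps \<in> interp N R"
  using assms unfolding partial_iso_def by blast

lemma ef_mono: "ef L M N k P \<Longrightarrow> Q \<subseteq> P \<Longrightarrow> ef L M N k Q"
proof (induction k arbitrary: P Q)
  case 0
  then show ?case by (auto intro: partial_iso_mono)
next
  case (Suc k)
  have "\<And>a b. ef L M N k (insert (a, b) P) \<Longrightarrow> ef L M N k (insert (a, b) Q)"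
    using Suc.IH Suc.prems(2) by (meson insert_mono)
  then show ?case using Suc.prems(1) unfolding ef.simps by meson
qed

text \<open>Nonemptiness provides a move for one further round; the pair it creates is then
  forgotten by monotonicity.\<close>

lemma ef_SucD: "ef L M N (Suc k) P \<Longrightarrow> universe M \<noteq> {} \<Longrightarrow> ef L M N k P"
  by (auto intro: ef_mono)

lemma ef_le:
  assumes "ef L M N k P" "j \<le> k" "universe M \<noteq> {}"
  shows "ef L M N j P"
  using assms(2,1) by (induction rule: dec_induct) (blast dest: ef_SucD[OF _ assms(3)])+

lemma list_of_imageE:
  assumes "set ys \<subseteq> f ` S"
  obtains xs where "ys = map f xs" "set xs \<subseteq> S"
proof -
  have "ys \<in> lists (f ` S)" using assms by auto
  then show ?thesis using that unfolding lists_image by auto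
qed

section \<open>Winning strategies preserve formulas of bounded quantifier rank\<close>

primrec quantifier_rank :: "'r fm \<Rightarrow> nat" where
  "quantifier_rank (Eq i j) = 0"
| "quantifier_rank (Rel R is) = 0"
| "quantifier_rank (Neg \<phi>) = quantifier_rank \<phi>"
| "quantifier_rank (Conj \<phi> \<psi>) = max (quantifier_rank \<phi>) (quantifier_rank \<psi>)"
| "quantifier_rank (Ex i \<phi>) = Suc (quantifier_rank \<phi>)"

primrec free_vars :: "'r fm \<Rightarrow> nat set" where
  "free_vars (Eq i j) = {i, j}"
| "free_vars (Rel R is) = set is"
| "free_vars (Neg \<phi>) = free_vars \<phi>"
| "free_vars (Conj \<phi> \<psi>) = free_vars \<phi> \<union> free_vars \<psi>"
| "free_vars (Ex i \<phi>) = free_vars \<phi> - {i}"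

lemma finite_free_vars: "finite (free_vars \<phi>)"
  by (induction \<phi>) auto

text \<open>Each quantifier uses up one round: a witness on either side is a move, and the reply is
  a witness on the other side. Only free variables must be matched in \<open>P\<close>, which lets
  \<open>P\<close> be finite in the application.\<close>

lemma ef_sat:
  assumes "formula_of L \<phi>" "ef L M N k P" "quantifier_rank \<phi> \<le> k"
    "\<And>j. j \<in> free_vars \<phi> \<Longrightarrow> (v j, w j) \<in> P"
    and ne: "universe M \<noteq> {}"
  shows "sat M v \<phi> \<longleftrightarrow> sat N w \<phi>"
  using assms(1-4)
proof (induction \<phi> arbitrary: k P v w)
  case (Eq i j)
  then have "partial_iso L M N P" using ef_le[OF Eq(2) _ ne, of 0] by simp
  then show ?case using Eq(4)[of i] Eq(4)[of j] by (fastforce simp: partial_iso_def)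
next
  case (Rel R js)
  then have "partial_iso L M N P" using ef_le[OF Rel(2) _ ne, of 0] by simp
  moreover have "R \<in> symbols L" using Rel(1) by simp
  moreover have "set (map (\<lambda>j. (v j, w j)) js) \<subseteq> P" using Rel(4) by auto
  moreover have "length (map (\<lambda>j. (v j, w j)) js) = arity L R" using Rel(1) by auto
  ultimately have "map fst (map (\<lambda>j. (v j, w j)) js) \<in> interp M R \<longleftrightarrow>
      map snd (map (\<lambda>j. (v j, w j)) js) \<in> interp N R"
    by (rule partial_isoD)
  then show ?case by (simp add: comp_def)
next
  case (Neg \<phi>)
  then show ?case by auto
next
  case (Conj \<phi> \<psi>)
  then have "sat M v \<phi> \<longleftrightarrow> sat N w \<phi>" "sat M v \<psi> \<longleftrightarrow> sat N w \<psi>"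
    by (auto intro!: Conj.IH[of k P])
  then show ?case by simp
next
  case (Ex i \<phi>)
  obtain l where l: "k = Suc l" "quantifier_rank \<phi> \<le> l"
    using Ex.prems(3) by (cases k) auto
  \<comment> \<open>The variable \<open>i\<close> is now matched by the new pair; every other free
    variable of \<open>\<phi>\<close> is free in \<open>Ex i \<phi>\<close> and keeps its old
    pair.\<close>
  have *: "sat M (v(i := a)) \<phi> \<longleftrightarrow> sat N (w(i := b)) \<phi>" if "ef L M N l (insert (a, b) P)" for a b
    using Ex.prems(1,4) l(2) by (intro Ex.IH[OF _ that]) auto
  show ?case using Ex.prems(2)[unfolded l(1) ef.simps] * unfolding sat.simps by blast
qed

section \<open>Agreement on finitely many formulas yields winning strategies\<close>

definition type_fm :: "'r fm set \<Rightarrow> 'r fm list \<Rightarrow> 'r fm" where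
  "type_fm s \<phi>s = foldr (\<lambda>\<phi>. Conj (if \<phi> \<in> s then \<phi> else Neg \<phi>)) \<phi>s (Eq 0 0)"

lemma sat_type_fm: "sat M v (type_fm s \<phi>s) \<longleftrightarrow> (\<forall>\<phi>\<in>set \<phi>s. sat M v \<phi> \<longleftrightarrow> \<phi> \<in> s)"
  unfolding type_fm_def by (induction \<phi>s) auto

lemma formula_of_type_fm: "\<forall>\<phi>\<in>set \<phi>s. formula_of L \<phi> \<Longrightarrow> formula_of L (type_fm s \<phi>s)"
  unfolding type_fm_def by (induction \<phi>s) auto

text \<open>Converse of \<open>ef_sat\<close>, in the manner of Hintikka formulas. With no rounds
  left, the atomic formulas in the first \<open>n\<close> variables suffice, and finitely many
  symbols give finitely many of them. For one more round, let \<open>T\<close> work for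
  \<open>n + 1\<close> variables: a move realises one of the finitely many complete types over
  \<open>T\<close>, and a reply realising the same type exists as soon as both sides agree on all
  formulas saying that such a type is realised.\<close>

lemma ef_determined_by_finite_set:
  fixes M :: "('r, 'a) rel_structure" and N :: "('r, 'b) rel_structure"
  assumes "finite (symbols L)"
  shows "\<exists>T. finite T \<and> (\<forall>\<phi>\<in>T. formula_of L \<phi>) \<and>
    (\<forall>v w. (\<forall>\<phi>\<in>T. sat M v \<phi> \<longleftrightarrow> sat N w \<phi>) \<longrightarrow> ef L M N k ((\<lambda>j. (v j, w j)) ` {..<n}))"
proof (induction k arbitrary: n)
  case 0
  define T where "T = (\<lambda>(i, j). Eq i j) ` ({..<n} \<times> {..<n}) \<union>
    (\<Union>R\<in>symbols L. Rel R ` {js. set js \<subseteq> {..<n} \<and> length js = arity L R})"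
  have "finite T" unfolding T_def using assms by (auto intro: finite_lists_length_eq)
  moreover have "\<forall>\<phi>\<in>T. formula_of L \<phi>" unfolding T_def by auto
  moreover have "partial_iso L M N ((\<lambda>j. (v j, w j)) ` {..<n})"
    if eqv: "\<forall>\<phi>\<in>T. sat M v \<phi> \<longleftrightarrow> sat N w \<phi>" for v w
    unfolding partial_iso_def
  proof (intro conjI ballI allI impI)
    fix p q assume "p \<in> (\<lambda>j. (v j, w j)) ` {..<n}" "q \<in> (\<lambda>j. (v j, w j)) ` {..<n}"
    then obtain i j where ij: "i < n" "j < n" "p = (v i, w i)" "q = (v j, w j)" by auto
    then have "Eq i j \<in> T" unfolding T_def by auto
    then show "fst p = fst q \<longleftrightarrow> snd p = snd q" using bspec[OF eqv, of "Eq i j"] ij by simp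
  next
    fix R ps
    assume R: "R \<in> symbols L" "set ps \<subseteq> (\<lambda>j. (v j, w j)) ` {..<n}" "length ps = arity L R"
    then obtain js where js: "ps = map (\<lambda>j. (v j, w j)) js" "set js \<subseteq> {..<n}"
      by (elim list_of_imageE)
    then have "Rel R js \<in> T" unfolding T_def using R by auto
    then show "map fst ps \<in> interp M R \<longleftrightarrow> map snd ps \<in> interp N R"
      using bspec[OF eqv, of "Rel R js"] js by (simp add: comp_def)
  qed
  ultimately show ?case by (intro exI[of _ T]) simp
next
  case (Suc k)
  obtain T where T: "finite T" "\<forall>\<phi>\<in>T. formula_of L \<phi>"
    "\<And>v w. \<forall>\<phi>\<in>T. sat M v \<phi> \<longleftrightarrow> sat N w \<phi> \<Longrightarrow> ef L M N k ((\<lambda>j. (v j, w j)) ` {..<Suc n})"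
    using Suc[of "Suc n"] by blast
  obtain \<phi>s where \<phi>s: "set \<phi>s = T" using T(1) finite_list by blast
  define T' where "T' = (\<lambda>s. Ex n (type_fm s \<phi>s)) ` Pow T"
  have "finite T'" unfolding T'_def using T(1) by simp
  moreover have "\<forall>\<phi>\<in>T'. formula_of L \<phi>"
    unfolding T'_def using formula_of_type_fm T(2) \<phi>s by fastforce
  moreover have "ef L M N (Suc k) ((\<lambda>j. (v j, w j)) ` {..<n})"
    if eqv: "\<forall>\<phi>\<in>T'. sat M v \<phi> \<longleftrightarrow> sat N w \<phi>" for v w
  proof -
    \<comment> \<open>The position occupies the variables below \<open>n\<close>, so
      \<open>n\<close> is free to hold the new pair.\<close>
    have upd: "(\<lambda>j. ((v(n := a)) j, (w(n := b)) j)) ` {..<Suc n} =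
        insert (a, b) ((\<lambda>j. (v j, w j)) ` {..<n})" for a b
      by (auto simp: lessThan_Suc)
    have step: "ef L M N k (insert (a, b) ((\<lambda>j. (v j, w j)) ` {..<n}))"
      if "\<forall>\<phi>\<in>T. sat M (v(n := a)) \<phi> \<longleftrightarrow> sat N (w(n := b)) \<phi>" for a b
      using T(3)[OF that] unfolding upd .
    have eqv': "sat M v (Ex n (type_fm s \<phi>s)) \<longleftrightarrow> sat N w (Ex n (type_fm s \<phi>s))" if "s \<subseteq> T" for s
      using eqv that unfolding T'_def by blast
    have "\<exists>b\<in>universe N. ef L M N k (insert (a, b) ((\<lambda>j. (v j, w j)) ` {..<n}))"
      if a: "a \<in> universe M" for a
    proof -
      \<comment> \<open>The subset of \<open>T\<close> chosen here is the type of the move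
        \<open>a\<close> itself; transferring the existential formula produces the reply.\<close>
      have "sat M v (Ex n (type_fm {\<phi>\<in>T. sat M (v(n := a)) \<phi>} \<phi>s))"
        using a by (auto simp: sat_type_fm \<phi>s)
      then have "sat N w (Ex n (type_fm {\<phi>\<in>T. sat M (v(n := a)) \<phi>} \<phi>s))"
        by (rule iffD1[OF eqv', rotated]) blast
      then obtain b where "b \<in> universe N" "\<forall>\<phi>\<in>T. sat M (v(n := a)) \<phi> \<longleftrightarrow> sat N (w(n := b)) \<phi>"
        by (auto simp: sat_type_fm \<phi>s)
      then show ?thesis using step by blast
    qed
    moreover have "\<exists>a\<in>universe M. ef L M N k (insert (a, b) ((\<lambda>j. (v j, w j)) ` {..<n}))"
      if b: "b \<in> universe N" for b
    proof -
      have "sat N w (Ex n (type_fm {\<phi>\<in>T. sat N (w(n := b)) \<phi>} \<phi>s))"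
        using b by (auto simp: sat_type_fm \<phi>s)
      then have "sat M v (Ex n (type_fm {\<phi>\<in>T. sat N (w(n := b)) \<phi>} \<phi>s))"
        by (rule iffD2[OF eqv', rotated]) blast
      then obtain a where "a \<in> universe M" "\<forall>\<phi>\<in>T. sat M (v(n := a)) \<phi> \<longleftrightarrow> sat N (w(n := b)) \<phi>"
        by (auto simp: sat_type_fm \<phi>s)
      then show ?thesis using step by blast
    qed
    ultimately show ?thesis by simp
  qed
  ultimately show ?case by (intro exI[of _ T']) blast
qed

lemma formula_of_mono:
  "formula_of L \<phi> \<Longrightarrow> symbols L \<subseteq> symbols L' \<Longrightarrow> arity L = arity L' \<Longrightarrow> formula_of L' \<phi>"
  by (induction \<phi>) auto

text \<open>The source of all strategies used later: from a finite identity position, an elementary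
  inclusion wins any number of rounds, as both sides agree on every formula at the same valuation.
  The restriction to a finite set \<open>F\<close> of symbols makes finitely many formulas
  sufficient.\<close>

lemma elementary_substructure_ef:
  assumes "elementary_substructure L A M" "finite F" "F \<subseteq> symbols L"
    "finite P" "P \<subseteq> Id_on (universe A)"
  shows "ef (L\<lparr>symbols := F\<rparr>) A M k P"
proof -
  obtain a0 where a0: "a0 \<in> universe A"
    using assms(1) by (auto simp: elementary_substructure_def substructure_def is_structure_def)
  obtain xs where xs: "set xs = fst ` P" using finite_list[of "fst ` P"] assms(4) by auto
  \<comment> \<open>The valuation enumerates the elements of the position. The default
    \<open>a0\<close> keeps its whole range inside \<open>A\<close>, as elementarity is stated for
    total valuations.\<close>
  define v where "v j = (if j < length xs then xs ! j else a0)" for j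
  have v: "range v \<subseteq> universe A"
  proof -
    have "set xs \<subseteq> universe A" unfolding xs using assms(5) by auto
    then show ?thesis using a0 by (auto simp: v_def dest: nth_mem)
  qed
  have P: "P \<subseteq> (\<lambda>j. (v j, v j)) ` {..<length xs}"
  proof
    fix p assume p: "p \<in> P"
    obtain j where "j < length xs" "xs ! j = fst p"
      using p xs by (metis image_eqI in_set_conv_nth)
    moreover have "p = (fst p, fst p)" using p assms(5) by auto
    ultimately have "p = (v j, v j)" "j < length xs" by (simp_all add: v_def)
    then show "p \<in> (\<lambda>j. (v j, v j)) ` {..<length xs}" by blast
  qed
  obtain T where T: "\<forall>\<phi>\<in>T. formula_of (L\<lparr>symbols := F\<rparr>) \<phi>"
    "\<And>v w. (\<forall>\<phi>\<in>T. sat A v \<phi> \<longleftrightarrow> sat M w \<phi>) \<Longrightarrow>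
       ef (L\<lparr>symbols := F\<rparr>) A M k ((\<lambda>j. (v j, w j)) ` {..<length xs})"
    using ef_determined_by_finite_set[of "L\<lparr>symbols := F\<rparr>" A M k "length xs"] assms(2)
    by auto
  have "formula_of L \<phi>" if "\<phi> \<in> T" for \<phi>
    using T(1) that assms(3) formula_of_mono[of "L\<lparr>symbols := F\<rparr>" \<phi> L] by simp
  then have "\<forall>\<phi>\<in>T. sat A v \<phi> \<longleftrightarrow> sat M v \<phi>"
    using assms(1) v unfolding elementary_substructure_def by blast
  from T(2)[OF this] P show ?thesis by (rule ef_mono)
qed

section \<open>Isomorphisms, restrictions and reducts\<close>

text \<open>Reading an isomorphism as a partial isomorphism on its graph lets the analysis of final
  positions of the product game serve for isomorphisms too.\<close>

lemma isomorphic_iff_partial_iso: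
  "isomorphic L M N \<longleftrightarrow> (\<exists>f. bij_betw f (universe M) (universe N) \<and>
     partial_iso L M N ((\<lambda>x. (x, f x)) ` universe M))"
proof -
  have "(\<forall>R\<in>symbols L. \<forall>xs\<in>tuples (arity L R) (universe M).
      xs \<in> interp M R \<longleftrightarrow> map f xs \<in> interp N R) \<longleftrightarrow>
      partial_iso L M N ((\<lambda>x. (x, f x)) ` universe M)" (is "?l \<longleftrightarrow> ?r")
    if f: "bij_betw f (universe M) (universe N)" for f
  proof
    assume l: ?l
    show ?r
      unfolding partial_iso_def
    proof (intro conjI ballI allI impI)
      fix p q assume "p \<in> (\<lambda>x. (x, f x)) ` universe M" "q \<in> (\<lambda>x. (x, f x)) ` universe M"
      then show "fst p = fst q \<longleftrightarrow> snd p = snd q"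
        using f by (auto simp: bij_betw_def inj_on_def)
    next
      fix R ps
      assume R: "R \<in> symbols L" "set ps \<subseteq> (\<lambda>x. (x, f x)) ` universe M" "length ps = arity L R"
      then obtain xs where xs: "ps = map (\<lambda>x. (x, f x)) xs" "set xs \<subseteq> universe M"
        by (elim list_of_imageE)
      then have "xs \<in> tuples (arity L R) (universe M)" using R by (simp add: tuples_def)
      then show "map fst ps \<in> interp M R \<longleftrightarrow> map snd ps \<in> interp N R"
        using l R(1) by (simp add: xs comp_def)
    qed
  next
    assume r: ?r
    show ?l
    proof (intro ballI)
      fix R xs assume R: "R \<in> symbols L" "xs \<in> tuples (arity L R) (universe M)"
      then have "set (map (\<lambda>x. (x, f x)) xs) \<subseteq> (\<lambda>x. (x, f x)) ` universe M"
        "length (map (\<lambda>x. (x, f x)) xs) = arity L R"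
        by (auto simp: tuples_def)
      then have "map fst (map (\<lambda>x. (x, f x)) xs) \<in> interp M R \<longleftrightarrow>
          map snd (map (\<lambda>x. (x, f x)) xs) \<in> interp N R"
        by (rule partial_isoD[OF r R(1)])
      then show "xs \<in> interp M R \<longleftrightarrow> map f xs \<in> interp N R" by (simp add: comp_def)
    qed
  qed
  then show ?thesis unfolding isomorphic_def by blast
qed

text \<open>Cutting down with \<open>lists U\<close> instead of tuples of a given arity avoids a
  language parameter, so the same restriction serves for \<open>L\<close> and its finite
  sublanguages.\<close>

definition restrict :: "('r, 'a) rel_structure \<Rightarrow> 'a set \<Rightarrow> ('r, 'a) rel_structure" where
  "restrict M U = \<lparr>universe = U, interp = (\<lambda>R. interp M R \<inter> lists U)\<rparr>"

lemma substructure_restrict: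
  assumes "is_structure L M" "U \<subseteq> universe M" "U \<noteq> {}"
  shows "substructure L (restrict M U) M"
  using assms unfolding substructure_def is_structure_def restrict_def tuples_def by fastforce

section \<open>Forgetting the relation \<open>s\<close>\<close>

definition reduct :: "('r option, 'a) rel_structure \<Rightarrow> ('r, 'a) rel_structure" where
  "reduct M = \<lparr>universe = universe M, interp = (\<lambda>R. interp M (Some R))\<rparr>"

lemma sat_reduct: "sat (reduct M) v \<phi> \<longleftrightarrow> sat M v (map_fm Some \<phi>)"
  by (induction \<phi> arbitrary: v) (auto simp: reduct_def)

lemma formula_of_add_s: "formula_of L \<phi> \<Longrightarrow> formula_of (add_s L) (map_fm Some \<phi>)"
  by (induction \<phi>) (auto simp: add_s_def)

lemma is_structure_reduct: "is_structure (add_s L) M \<Longrightarrow> is_structure L (reduct M)"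
  by (auto simp: is_structure_def reduct_def add_s_def)

lemma elementary_substructure_reduct:
  assumes "elementary_substructure (add_s L) A M"
  shows "elementary_substructure L (reduct A) (reduct M)"
proof -
  have "substructure L (reduct A) (reduct M)"
    using assms is_structure_reduct[of L]
    by (auto simp: elementary_substructure_def substructure_def reduct_def add_s_def)
  then show ?thesis
    using assms formula_of_add_s[of L]
    by (auto simp: elementary_substructure_def sat_reduct) (auto simp: reduct_def)
qed

lemma isomorphic_reduct: "isomorphic (add_s L) A M \<Longrightarrow> isomorphic L (reduct A) (reduct M)"
  unfolding isomorphic_def by (auto simp: reduct_def add_s_def)

text \<open>A reduct has the same universe, hence the same colourings, and the reduct of a good copy
  is again a good copy. Thus only the product with \<open>s\<close> has to be treated.\<close>

lemma elementarily_indivisible_reduct: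
  assumes "elementarily_indivisible (add_s L) M"
  shows "elementarily_indivisible L (reduct M)"
  unfolding elementarily_indivisible_def
proof (intro conjI allI)
  show "is_structure L (reduct M)"
    using assms is_structure_reduct unfolding elementarily_indivisible_def by blast
next
  fix c
  obtain A where "monochromatic c (universe A)" "isomorphic (add_s L) A M"
    "elementary_substructure (add_s L) A M"
    using assms unfolding elementarily_indivisible_def by blast
  then have "monochromatic c (universe (reduct A)) \<and> isomorphic L (reduct A) (reduct M) \<and>
      elementary_substructure L (reduct A) (reduct M)"
    using isomorphic_reduct elementary_substructure_reduct by (auto simp: reduct_def)
  then show "\<exists>A. monochromatic c (universe A) \<and> isomorphic L A (reduct M) \<and>
      elementary_substructure L A (reduct M)"
    by blast
qed

section \<open>Games on the lexicographic product\<close>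

lemma reduct_lexicographic_product_s:
  "reduct (lexicographic_product_s L M N) = lexicographic_product L M N"
  by (simp add: reduct_def lexicographic_product_s_def lexicographic_product_def)

lemma universe_lexicographic_product_s:
  "universe (lexicographic_product_s L M N) = universe M \<times> universe N"
  by (simp add: lexicographic_product_s_def lexicographic_product_def)

lemma is_structure_lexicographic_product_s:
  assumes "is_structure L M" "is_structure L N"
  shows "is_structure (add_s L) (lexicographic_product_s L M N)"
  using assms
  by (auto simp: is_structure_def lexicographic_product_s_def lexicographic_product_def add_s_def
      tuples_def)

text \<open>A position \<open>Q\<close> of the product game splits into a base position, the image
  of \<open>Q\<close> under \<open>map_prod fst fst\<close>, and one position of second coordinates
  over each base pair.\<close>

definition fibre :: "(('a \<times> 'b) \<times> ('c \<times> 'd)) set \<Rightarrow> 'a \<Rightarrow> 'c \<Rightarrow> ('b \<times> 'd) set" where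
  "fibre Q a a' = {(b, b'). ((a, b), (a', b')) \<in> Q}"

lemma fibre_memI:
  "p \<in> Q \<Longrightarrow> fst (fst p) = a \<Longrightarrow> fst (snd p) = a' \<Longrightarrow> map_prod snd snd p \<in> fibre Q a a'"
  by (cases p) (auto simp: fibre_def)

lemma fibre_subset: "fibre Q a a' \<subseteq> map_prod snd snd ` Q"
proof clarify
  fix b b' assume "(b, b') \<in> fibre Q a a'"
  then have "((a, b), (a', b')) \<in> Q" by (simp add: fibre_def)
  then show "(b, b') \<in> map_prod snd snd ` Q" by (rule rev_image_eqI) simp
qed

text \<open>Only substructures are assumed, not elementary ones, so the locale can be instantiated
  for \<open>L\<close> and again for a finite sublanguage.\<close>

locale sub_product =
  fixes L :: "'r rel_language"
    and M M0 :: "('r, 'a) rel_structure"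
    and N :: "('r, 'b) rel_structure"
    and Nf :: "'a \<Rightarrow> ('r, 'b) rel_structure"
  assumes sub_M: "substructure L M0 M"
    and sub_N: "\<And>a. a \<in> universe M0 \<Longrightarrow> substructure L (Nf a) N"
begin

abbreviation product where
  "product \<equiv> lexicographic_product_s L M N"

abbreviation subuniverse where
  "subuniverse \<equiv> SIGMA a:universe M0. universe (Nf a)"

abbreviation subproduct where
  "subproduct \<equiv> restrict product subuniverse"

lemma M0_subset: "universe M0 \<subseteq> universe M"
  using sub_M by (simp add: substructure_def)

lemma Nf_subset: "a \<in> universe M0 \<Longrightarrow> universe (Nf a) \<subseteq> universe N"
  using sub_N by (simp add: substructure_def)

lemma M0_nonempty: "universe M0 \<noteq> {}"
  using sub_M by (simp add: substructure_def is_structure_def)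

lemma Nf_nonempty: "a \<in> universe M0 \<Longrightarrow> universe (Nf a) \<noteq> {}"
  using sub_N by (simp add: substructure_def is_structure_def)

lemma subuniverse_nonempty: "subuniverse \<noteq> {}"
  using M0_nonempty Nf_nonempty by fastforce

lemma subproduct_substructure: "substructure (add_s L) subproduct product"
proof (rule substructure_restrict)
  obtain a where "a \<in> universe M0" using M0_nonempty by blast
  then have "is_structure L N" using sub_N by (simp add: substructure_def)
  then show "is_structure (add_s L) product"
    using sub_M by (intro is_structure_lexicographic_product_s) (simp_all add: substructure_def)
  show "subuniverse \<subseteq> universe product"
    using M0_subset Nf_subset unfolding universe_lexicographic_product_s by blast
qed (rule subuniverse_nonempty)

lemma interp_M0:
  assumes "R \<in> symbols L" "length xs = arity L R" "set xs \<subseteq> universe M0"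
  shows "xs \<in> interp M R \<longleftrightarrow> xs \<in> interp M0 R"
  using sub_M assms by (simp add: substructure_def tuples_def)

lemma interp_Nf:
  assumes "a \<in> universe M0" "R \<in> symbols L" "length xs = arity L R" "set xs \<subseteq> universe (Nf a)"
  shows "xs \<in> interp N R \<longleftrightarrow> xs \<in> interp (Nf a) R"
  using sub_N[OF assms(1)] assms(2-4) by (simp add: substructure_def tuples_def)

text \<open>The two clauses of the product exclude each other. The empty tuple counts as constant in
  the first coordinate, so a nullary symbol is read in \<open>N\<close>.\<close>

lemma interp_product_Some:
  assumes "length ps = arity L R" "set ps \<subseteq> universe M \<times> universe N"
  shows "ps \<in> interp product (Some R) \<longleftrightarrow>
    (if \<forall>p\<in>set ps. \<forall>q\<in>set ps. fst p = fst q then map snd ps \<in> interp N R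
     else map fst ps \<in> interp M R)"
proof -
  have "ps \<in> tuples (arity L R) (universe M \<times> universe N)" using assms by (simp add: tuples_def)
  then show ?thesis
    unfolding if_bool_eq_disj by (simp add: lexicographic_product_s_def lexicographic_product_def)
qed

lemma interp_product_None:
  assumes "p \<in> universe M \<times> universe N" "q \<in> universe M \<times> universe N"
  shows "[p, q] \<in> interp product None \<longleftrightarrow> fst p = fst q"
  using assms by (cases p; cases q) (auto simp: lexicographic_product_s_def)

text \<open>The base position preserves and reflects equality of first coordinates. This settles
  \<open>s\<close>, and it shows that a tuple lies in a single fibre on one side iff it does on the
  other; a symbol of \<open>L\<close> is then decided by the fibre position in that case and by the
  base position otherwise.\<close>

lemma partial_iso_product:
  assumes Q: "Q \<subseteq> subuniverse \<times> (universe M \<times> universe N)"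
    and base: "partial_iso L M0 M (map_prod fst fst ` Q)"
    and fibres: "\<And>a a'. (a, a') \<in> map_prod fst fst ` Q \<Longrightarrow> partial_iso L (Nf a) N (fibre Q a a')"
  shows "partial_iso (add_s L) subproduct product Q"
proof -
  have base_eq: "fst (fst p) = fst (fst q) \<longleftrightarrow> fst (snd p) = fst (snd q)"
    if "p \<in> Q" "q \<in> Q" for p q
    using base that unfolding partial_iso_def
    by (metis (no_types, lifting) fst_map_prod image_eqI snd_map_prod)
  have eq: "fst p = fst q \<longleftrightarrow> snd p = snd q" if pq: "p \<in> Q" "q \<in> Q" for p q
  proof (cases "fst (fst p) = fst (fst q)")
    case True
    define a a' where "a = fst (fst p)" "a' = fst (snd p)"
    have a: "fst (fst q) = a" "fst (snd q) = a'"
      using base_eq[OF pq] True by (auto simp: a_a'_def)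
    have "(a, a') \<in> map_prod fst fst ` Q"
      using pq(1) by (force simp: a_a'_def)
    from fibres[OF this] have
      "\<forall>x\<in>fibre Q a a'. \<forall>y\<in>fibre Q a a'. fst x = fst y \<longleftrightarrow> snd x = snd y"
      by (simp add: partial_iso_def)
    moreover have "map_prod snd snd p \<in> fibre Q a a'" "map_prod snd snd q \<in> fibre Q a a'"
      using pq a by (auto intro: fibre_memI simp: a_a'_def)
    ultimately have "snd (fst p) = snd (fst q) \<longleftrightarrow> snd (snd p) = snd (snd q)" by fastforce
    then show ?thesis using True base_eq[OF pq] by (simp add: prod_eq_iff)
  next
    case False
    then show ?thesis using base_eq[OF pq] by auto
  qed
  have Some: "map fst ps \<in> interp subproduct (Some R) \<longleftrightarrow> map snd ps \<in> interp product (Some R)"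
    if R: "R \<in> symbols L" and ps: "set ps \<subseteq> Q" and len: "length ps = arity L R" for R ps
  proof -
    have ps_U: "set (map fst ps) \<subseteq> subuniverse" using ps Q by auto
    then have ps_S: "set (map fst ps) \<subseteq> universe M \<times> universe N"
      using M0_subset Nf_subset by fastforce
    have ps_S': "set (map snd ps) \<subseteq> universe M \<times> universe N" using ps Q by fastforce
    have lists: "map fst ps \<in> lists subuniverse" using ps_U by blast
    let ?const = "\<forall>p\<in>set ps. \<forall>q\<in>set ps. fst (fst p) = fst (fst q)"
    have const': "?const \<longleftrightarrow> (\<forall>p\<in>set ps. \<forall>q\<in>set ps. fst (snd p) = fst (snd q))"
      by (intro ball_cong refl base_eq subsetD[OF ps])
    have left: "map fst ps \<in> interp subproduct (Some R) \<longleftrightarrow>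
        (if ?const then map (snd \<circ> fst) ps \<in> interp N R else map (fst \<circ> fst) ps \<in> interp M R)"
    proof -
      have "map fst ps \<in> interp subproduct (Some R) \<longleftrightarrow> map fst ps \<in> interp product (Some R)"
        using lists by (simp add: restrict_def)
      also have "\<dots> \<longleftrightarrow> (if ?const then map (snd \<circ> fst) ps \<in> interp N R
          else map (fst \<circ> fst) ps \<in> interp M R)"
        using interp_product_Some[of "map fst ps" R] len ps_S
        by (simp only: length_map list.set_map ball_simps map_map)
      finally show ?thesis .
    qed
    have right: "map snd ps \<in> interp product (Some R) \<longleftrightarrow>
        (if ?const then map (snd \<circ> snd) ps \<in> interp N R else map (fst \<circ> snd) ps \<in> interp M R)"
      using interp_product_Some[of "map snd ps" R] len ps_S'
      by (simp only: const' length_map list.set_map ball_simps map_map)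
    show ?thesis
    proof (cases ?const)
      case True
      have "map (snd \<circ> fst) ps \<in> interp N R \<longleftrightarrow> map (snd \<circ> snd) ps \<in> interp N R"
      \<comment> \<open>The empty tuple has no head from which to read off a base pair; for it both
        sides coincide.\<close>
      proof (cases "ps = []")
        case False
        define a a' where "a = fst (fst (hd ps))" "a' = fst (snd (hd ps))"
        have hd: "hd ps \<in> set ps" using False by simp
        have a: "fst (fst p) = a" "fst (snd p) = a'" if "p \<in> set ps" for p
          using bspec[OF bspec[OF True that] hd] base_eq[OF subsetD[OF ps that] subsetD[OF ps hd]]
          unfolding a_a'_def by blast+
        have "a \<in> universe M0" using hd ps Q by (fastforce simp: a_a'_def)
        moreover have "set (map (snd \<circ> fst) ps) \<subseteq> universe (Nf a)"
          using ps_U a(1) by fastforce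
        ultimately have "map (snd \<circ> fst) ps \<in> interp N R \<longleftrightarrow> map (snd \<circ> fst) ps \<in> interp (Nf a) R"
          using interp_Nf R len by simp
        moreover have iso: "partial_iso L (Nf a) N (fibre Q a a')"
          using hd ps by (intro fibres) (force simp: a_a'_def)
        moreover have "set (map (map_prod snd snd) ps) \<subseteq> fibre Q a a'"
          unfolding set_map by (intro image_subsetI fibre_memI a subsetD[OF ps])
        ultimately show ?thesis
          using partial_isoD[OF iso R, of "map (map_prod snd snd) ps"] len by (simp add: comp_def)
      qed simp
      then show ?thesis unfolding left right if_P[OF True] .
    next
      case False
      \<comment> \<open>The subproduct takes its relations from the full product, so the tuple is
        evaluated in \<open>M\<close>, whereas the base position compares \<open>M0\<close> with
        \<open>M\<close>.\<close>
      have "map (fst \<circ> fst) ps \<in> interp M R \<longleftrightarrow> map (fst \<circ> fst) ps \<in> interp M0 R"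
        using R len ps_U by (intro interp_M0) auto
      moreover have "set (map (map_prod fst fst) ps) \<subseteq> map_prod fst fst ` Q" using ps by auto
      ultimately have "map (fst \<circ> fst) ps \<in> interp M R \<longleftrightarrow> map (fst \<circ> snd) ps \<in> interp M R"
        using partial_isoD[OF base R, of "map (map_prod fst fst) ps"] len by (simp add: comp_def)
      then show ?thesis unfolding left right if_not_P[OF False] .
    qed
  qed
  have None: "map fst ps \<in> interp subproduct None \<longleftrightarrow> map snd ps \<in> interp product None"
    if ps: "set ps \<subseteq> Q" and len: "length ps = 2" for ps
  proof -
    obtain p q where pq: "ps = [p, q]" using len by (auto simp: numeral_2_eq_2 length_Suc_conv)
    have "fst p \<in> subuniverse" "fst q \<in> subuniverse"
      "snd p \<in> universe M \<times> universe N" "snd q \<in> universe M \<times> universe N"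
      using ps Q pq by fastforce+
    moreover from this have "fst p \<in> universe M \<times> universe N" "fst q \<in> universe M \<times> universe N"
      using M0_subset Nf_subset by fastforce+
    moreover have "p \<in> Q" "q \<in> Q" using ps pq by auto
    ultimately show ?thesis
      using base_eq[of p q] by (simp add: pq restrict_def interp_product_None del: mem_Sigma_iff)
  qed
  show ?thesis
    unfolding partial_iso_def using eq Some None by (auto simp: add_s_def)
qed

text \<open>Composition of strategies: the reply to a pair takes its first coordinate from the base
  game and its second from the game over the resulting base pair. The assumption
  \<open>equiv\<close> starts the game over a base pair that occurs for the first time.\<close>

lemma ef_product:
  assumes equiv: "\<And>a k. a \<in> universe M0 \<Longrightarrow> ef L (Nf a) N k {}"
  shows "\<lbrakk>Q \<subseteq> subuniverse \<times> (universe M \<times> universe N);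
      ef L M0 M k (map_prod fst fst ` Q);
      \<And>a a'. (a, a') \<in> map_prod fst fst ` Q \<Longrightarrow> ef L (Nf a) N k (fibre Q a a')\<rbrakk>
    \<Longrightarrow> ef (add_s L) subproduct product k Q"
proof (induction k arbitrary: Q)
  case 0
  then show ?case using partial_iso_product[of Q] by simp
next
  case (Suc k)
  \<comment> \<open>Over a base pair not yet played the fibre position is empty, so
    \<open>equiv\<close> applies.\<close>
  have fibre: "ef L (Nf a) N (Suc k) (fibre Q a a')" if "a \<in> universe M0" for a a'
  proof (cases "(a, a') \<in> map_prod fst fst ` Q")
    case False
    then have "fibre Q a a' = {}" by (force simp: fibre_def)
    then show ?thesis using equiv[OF that] by (simp del: ef.simps)
  qed (rule Suc.prems(3))
  have step: "ef (add_s L) subproduct product k (insert ((a, b), (a', b')) Q)"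
    if "a \<in> universe M0" "b \<in> universe (Nf a)" "a' \<in> universe M" "b' \<in> universe N"
      and base: "ef L M0 M k (insert (a, a') (map_prod fst fst ` Q))"
      and fib: "ef L (Nf a) N k (insert (b, b') (fibre Q a a'))" for a b a' b'
  proof (rule Suc.IH)
    show "insert ((a, b), (a', b')) Q \<subseteq> subuniverse \<times> (universe M \<times> universe N)"
      using that Suc.prems(1) by auto
    show "ef L M0 M k (map_prod fst fst ` insert ((a, b), (a', b')) Q)" using base by simp
  next
    fix c c' assume c: "(c, c') \<in> map_prod fst fst ` insert ((a, b), (a', b')) Q"
    show "ef L (Nf c) N k (fibre (insert ((a, b), (a', b')) Q) c c')"
    proof (cases "(c, c') = (a, a')")
      case True
      then have "fibre (insert ((a, b), (a', b')) Q) c c' = insert (b, b') (fibre Q a a')"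
        by (auto simp: fibre_def)
      then show ?thesis using fib True by simp
    next
      case False
      then have eq: "fibre (insert ((a, b), (a', b')) Q) c c' = fibre Q c c'"
        by (auto simp: fibre_def)
      have "c \<in> universe M0" using c Suc.prems(1) that(1) by auto
      \<comment> \<open>Fibres other than the one just played in keep their position and merely give
        up a round.\<close>
      then show ?thesis unfolding eq by (intro ef_SucD[OF fibre] Nf_nonempty)
    qed
  qed
  show ?case
    unfolding ef.simps
  proof (intro conjI ballI)
    fix p assume "p \<in> universe subproduct"
    then obtain a b where p: "p = (a, b)" "a \<in> universe M0" "b \<in> universe (Nf a)"
      by (auto simp: restrict_def)
    obtain a' where a': "a' \<in> universe M" "ef L M0 M k (insert (a, a') (map_prod fst fst ` Q))"
      using Suc.prems(2) p(2) by auto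
    obtain b' where "b' \<in> universe N" "ef L (Nf a) N k (insert (b, b') (fibre Q a a'))"
      using fibre[OF p(2)] p(3) unfolding ef.simps by blast
    then show "\<exists>q\<in>universe product. ef (add_s L) subproduct product k (insert (p, q) Q)"
      using step[OF p(2,3)] a' p(1) by (auto simp: universe_lexicographic_product_s)
  next
    fix q assume "q \<in> universe product"
    then obtain a' b' where q: "q = (a', b')" "a' \<in> universe M" "b' \<in> universe N"
      by (auto simp: universe_lexicographic_product_s)
    obtain a where a: "a \<in> universe M0" "ef L M0 M k (insert (a, a') (map_prod fst fst ` Q))"
      using Suc.prems(2) q(2) by auto
    obtain b where "b \<in> universe (Nf a)" "ef L (Nf a) N k (insert (b, b') (fibre Q a a'))"
      using fibre[OF a(1)] q(3) unfolding ef.simps by blast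
    then show "\<exists>p\<in>universe subproduct. ef (add_s L) subproduct product k (insert (p, q) Q)"
      using step[OF a(1) _ q(2,3)] a q(1) by (auto simp: restrict_def)
  qed
qed

text \<open>An isomorphism of the bases and one for each fibre are glued to \<open>h\<close>. The
  graph of \<open>h\<close> projects into the graph of \<open>f\<close>, and its fibres lie in the
  graphs of the maps \<open>g a\<close>, so \<open>partial_iso_product\<close> applies.\<close>

lemma isomorphic_product:
  assumes iso_M: "isomorphic L M0 M"
    and iso_N: "\<And>a. a \<in> universe M0 \<Longrightarrow> isomorphic L (Nf a) N"
  shows "isomorphic (add_s L) subproduct product"
proof -
  obtain f where f: "bij_betw f (universe M0) (universe M)"
    "partial_iso L M0 M ((\<lambda>x. (x, f x)) ` universe M0)"
    using iso_M unfolding isomorphic_iff_partial_iso by blast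
  have "\<forall>a\<in>universe M0. \<exists>h. bij_betw h (universe (Nf a)) (universe N) \<and>
      partial_iso L (Nf a) N ((\<lambda>x. (x, h x)) ` universe (Nf a))"
    using iso_N unfolding isomorphic_iff_partial_iso by blast
  then obtain g where g: "\<And>a. a \<in> universe M0 \<Longrightarrow> bij_betw (g a) (universe (Nf a)) (universe N)"
    "\<And>a. a \<in> universe M0 \<Longrightarrow> partial_iso L (Nf a) N ((\<lambda>x. (x, g a x)) ` universe (Nf a))"
    by metis
  define h where "h = (\<lambda>(a, b). (f a, g a b))"
  have f_inj: "f a = f c \<longleftrightarrow> a = c" if "a \<in> universe M0" "c \<in> universe M0" for a c
    using f(1) that by (auto simp: bij_betw_def inj_on_def)
  have f_mem: "f a \<in> universe M" if "a \<in> universe M0" for a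
    using f(1) that by (auto simp: bij_betw_def)
  have g_mem: "g a b \<in> universe N" if "a \<in> universe M0" "b \<in> universe (Nf a)" for a b
    using g(1)[OF that(1)] that(2) by (auto simp: bij_betw_def)
  have "bij_betw h (universe subproduct) (universe product)"
    unfolding bij_betw_def
  proof
    show "inj_on h (universe subproduct)"
      using g(1) f_inj by (auto simp: inj_on_def h_def restrict_def bij_betw_def)
    have "(c, d) \<in> h ` subuniverse" if cd: "c \<in> universe M" "d \<in> universe N" for c d
    proof -
      have "c \<in> f ` universe M0" using cd(1) by (simp add: bij_betw_imp_surj_on[OF f(1)])
      then obtain a where a: "a \<in> universe M0" "c = f a" by (rule imageE)
      have "d \<in> g a ` universe (Nf a)"
        using cd(2) by (simp add: bij_betw_imp_surj_on[OF g(1)[OF a(1)]])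
      then obtain b where b: "b \<in> universe (Nf a)" "d = g a b" by (rule imageE)
      show ?thesis unfolding h_def using a b by (intro image_eqI[of _ _ "(a, b)"]) auto
    qed
    then show "h ` universe subproduct = universe product"
      using f_mem g_mem
      by (auto simp: h_def restrict_def universe_lexicographic_product_s)
  qed
  moreover have "partial_iso (add_s L) subproduct product ((\<lambda>x. (x, h x)) ` universe subproduct)"
  proof (rule partial_iso_product)
    show "(\<lambda>x. (x, h x)) ` universe subproduct \<subseteq> subuniverse \<times> (universe M \<times> universe N)"
      using f_mem g_mem by (auto simp: h_def restrict_def)
    show "partial_iso L M0 M (map_prod fst fst ` (\<lambda>x. (x, h x)) ` universe subproduct)"
      by (rule partial_iso_mono[OF f(2)]) (auto simp: h_def restrict_def)
  next
    fix a a'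
    assume "(a, a') \<in> map_prod fst fst ` (\<lambda>x. (x, h x)) ` universe subproduct"
    then have "a \<in> universe M0" by (auto simp: restrict_def)
    then show "partial_iso L (Nf a) N (fibre ((\<lambda>x. (x, h x)) ` universe subproduct) a a')"
      by (rule partial_iso_mono[OF g(2)]) (auto simp: fibre_def h_def restrict_def)
  qed
  ultimately show ?thesis unfolding isomorphic_iff_partial_iso by blast
qed

end

section \<open>Finite sublanguages and elementarity of the subproduct\<close>

lemma symbols_of_formula:
  assumes "formula_of (add_s L) \<phi>"
  shows "\<exists>F. finite F \<and> F \<subseteq> symbols L \<and> formula_of (add_s (L\<lparr>symbols := F\<rparr>)) \<phi>"
  using assms
proof (induction \<phi>)
  case (Rel R js)
  then show ?case
    \<comment> \<open>The symbol \<open>None\<close> is \<open>s\<close>, which \<open>add_s\<close>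
      always provides, so it costs no symbol of \<open>L\<close>.\<close>
    by (intro exI[of _ "case R of None \<Rightarrow> {} | Some S \<Rightarrow> {S}"])
      (auto simp: add_s_def split: option.splits)
next
  case (Conj \<phi> \<psi>)
  then obtain F G where FG: "finite F" "F \<subseteq> symbols L" "formula_of (add_s (L\<lparr>symbols := F\<rparr>)) \<phi>"
    "finite G" "G \<subseteq> symbols L" "formula_of (add_s (L\<lparr>symbols := G\<rparr>)) \<psi>"
    by auto
  have "formula_of (add_s (L\<lparr>symbols := F \<union> G\<rparr>)) \<phi>" "formula_of (add_s (L\<lparr>symbols := F \<union> G\<rparr>)) \<psi>"
    by (rule formula_of_mono[OF FG(3)] formula_of_mono[OF FG(6)]; auto simp: add_s_def)+
  then show ?case using FG by (intro exI[of _ "F \<union> G"]) simp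
qed auto

lemma substructure_sublanguage:
  "substructure L A M \<Longrightarrow> F \<subseteq> symbols L \<Longrightarrow> substructure (L\<lparr>symbols := F\<rparr>) A M"
  unfolding substructure_def is_structure_def by auto

text \<open>A single formula mentions finitely many symbols, so it suffices to win the game over
  that finite sublanguage, for as many rounds as the quantifier rank, from the identity position on
  the values of its free variables. The base projection and the fibres of that position are identity
  positions again.\<close>

lemma elementary_substructure_product:
  fixes M M0 :: "('r, 'a) rel_structure" and N :: "('r, 'b) rel_structure"
  assumes el_M: "elementary_substructure L M0 M"
    and el_N: "\<And>a. a \<in> universe M0 \<Longrightarrow> elementary_substructure L (Nf a) N"
  shows "elementary_substructure (add_s L)
    (restrict (lexicographic_product_s L M N) (SIGMA a:universe M0. universe (Nf a)))
    (lexicographic_product_s L M N)"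
  unfolding elementary_substructure_def
proof (intro conjI allI impI)
  interpret sub_product L M M0 N Nf
    using assms by unfold_locales (auto simp: elementary_substructure_def)
  show "substructure (add_s L) subproduct product" by (rule subproduct_substructure)
  fix \<phi> and v :: "nat \<Rightarrow> 'a \<times> 'b"
  assume \<phi>: "formula_of (add_s L) \<phi>" and v: "range v \<subseteq> universe subproduct"
  obtain F where F: "finite F" "F \<subseteq> symbols L" "formula_of (add_s (L\<lparr>symbols := F\<rparr>)) \<phi>"
    using symbols_of_formula[OF \<phi>] by blast
  interpret fin: sub_product "L\<lparr>symbols := F\<rparr>" M M0 N Nf
    using sub_M sub_N F(2) by unfold_locales (auto intro: substructure_sublanguage)
  \<comment> \<open>The product depends on the language only through the arities, which the
    sublanguage shares, so satisfaction need not be transferred.\<close>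
  have fin_product: "fin.product = product"
    by (simp add: lexicographic_product_s_def lexicographic_product_def)
  let ?Q = "(\<lambda>j. (v j, v j)) ` free_vars \<phi>"
  have v_mem: "v j \<in> subuniverse" for j using v by (auto simp: restrict_def)
  have v_fst: "fst (v j) \<in> universe M0" and v_snd: "snd (v j) \<in> universe (Nf (fst (v j)))" for j
    using v_mem[of j] by (cases "v j"; simp)+
  have v_prod: "v j \<in> universe M \<times> universe N" for j
    using v_fst[of j] v_snd[of j] M0_subset Nf_subset[OF v_fst, of j] by (cases "v j") auto
  have ef: "ef (add_s (L\<lparr>symbols := F\<rparr>)) fin.subproduct fin.product (quantifier_rank \<phi>) ?Q"
  proof (rule fin.ef_product)
    show "ef (L\<lparr>symbols := F\<rparr>) (Nf a) N k {}" if "a \<in> universe M0" for a k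
      using elementary_substructure_ef[OF el_N[OF that] F(1,2)] by simp
    show "?Q \<subseteq> subuniverse \<times> (universe M \<times> universe N)"
      using v_mem v_prod by (intro image_subsetI SigmaI)
    show "ef (L\<lparr>symbols := F\<rparr>) M0 M (quantifier_rank \<phi>) (map_prod fst fst ` ?Q)"
      using v_fst finite_free_vars by (intro elementary_substructure_ef[OF el_M F(1,2)]) auto
  next
    fix a a' assume "(a, a') \<in> map_prod fst fst ` ?Q"
    then have a: "a \<in> universe M0" using v_fst by auto
    show "ef (L\<lparr>symbols := F\<rparr>) (Nf a) N (quantifier_rank \<phi>) (fibre ?Q a a')"
    proof (rule elementary_substructure_ef[OF el_N[OF a] F(1,2)])
      show "finite (fibre ?Q a a')" 
        by (rule finite_subset[OF fibre_subset]) (simp add: finite_free_vars)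
      show "fibre ?Q a a' \<subseteq> Id_on (universe (Nf a))"
      proof
        fix x assume "x \<in> fibre ?Q a a'"
        then obtain j where j: "(a, fst x) = v j" "(a', snd x) = v j" by (auto simp: fibre_def)
        \<comment> \<open>Both members of a pair in the position are the same \<open>v j\<close>, so
          \<open>a\<close> equals \<open>a'\<close> and the second coordinates agree.\<close>
        then have "snd x = fst x" by (metis prod.inject)
        then show "x \<in> Id_on (universe (Nf a))" using v_snd[of j] j(1)[symmetric] by (cases x) auto
      qed
    qed
  qed
  show "sat subproduct v \<phi> \<longleftrightarrow> sat product v \<phi>"
    using ef_sat[OF F(3) ef order.refl, of v v] subuniverse_nonempty
    unfolding fin_product by (simp add: restrict_def)
qed

section \<open>The colouring argument\<close>

lemma elementarily_indivisible_lexicographic_product_s: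
  assumes M: "elementarily_indivisible L M" and N: "elementarily_indivisible L N"
  shows "elementarily_indivisible (add_s L) (lexicographic_product_s L M N)"
  unfolding elementarily_indivisible_def
proof (intro conjI allI)
  show "is_structure (add_s L) (lexicographic_product_s L M N)"
    using assms by (simp add: elementarily_indivisible_def is_structure_lexicographic_product_s)
next
  fix c :: "'b \<times> 'c \<Rightarrow> bool"
  have "\<forall>a. \<exists>A. monochromatic (\<lambda>b. c (a, b)) (universe A) \<and> isomorphic L A N \<and>
      elementary_substructure L A N"
    using N unfolding elementarily_indivisible_def by blast
  then obtain Nf where Nf: "\<And>a. monochromatic (\<lambda>b. c (a, b)) (universe (Nf a))"
    "\<And>a. isomorphic L (Nf a) N" "\<And>a. elementary_substructure L (Nf a) N"
    by metis
  \<comment> \<open>\<open>d\<close> colours the base by the common colour of the chosen copy over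
    each point; indivisibility of \<open>M\<close> is applied to this colouring.\<close>
  obtain d where d: "\<And>a b. b \<in> universe (Nf a) \<Longrightarrow> c (a, b) = d a"
    using Nf(1) unfolding monochromatic_def by metis
  obtain M0 where M0: "monochromatic d (universe M0)" "isomorphic L M0 M"
    "elementary_substructure L M0 M"
    using M unfolding elementarily_indivisible_def by blast
  interpret sub_product L M M0 N Nf
    using M0(3) Nf(3) by unfold_locales (auto simp: elementary_substructure_def)
  have "monochromatic c (universe subproduct)"
    using M0(1) d by (fastforce simp: monochromatic_def restrict_def)
  then show "\<exists>A. monochromatic c (universe A) \<and> isomorphic (add_s L) A product \<and>
      elementary_substructure (add_s L) A product"
    using isomorphic_product[OF M0(2) Nf(2)]
      elementary_substructure_product[where Nf = Nf, OF M0(3) Nf(3)] by blast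
qed

theorem theorem2p20:
  fixes L :: "'r rel_language"
    and M :: "('r, 'a) rel_structure"
    and N :: "('r, 'b) rel_structure"
  assumes "elementarily_indivisible L M"
    and "elementarily_indivisible L N"
  shows "elementarily_indivisible L (lexicographic_product L M N) \<and>
         elementarily_indivisible (add_s L) (lexicographic_product_s L M N)"
  using elementarily_indivisible_lexicographic_product_s[OF assms]
    elementarily_indivisible_reduct[of L "lexicographic_product_s L M N"]
  by (simp add: reduct_lexicographic_product_s)

end
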